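(* Let $n\ge2$ and let $D:2^{[n]}\to\mathbb R$ satisfy $D(\varnothing)=0$ and $D(\{i\})=1$ for all $i\in[n]$. For each nonempty $B\subseteq[n]$, put $$\widehat c_B(D):=-\sum_{A\subseteq B}(-1)^{|B|-|A|}D([n]\setminus A).$$ These are the unique real (signed) coefficients satisfying $$D(H)=\sum_{B:\,B\cap H\ne\varnothing}\widehat c_B(D)\quad(H\subseteq[n]),\qquad \sum_{B\ni i}\widehat c_B(D)=1\quad(i\in[n]).$$ For $n\ge3$, the classical region $\mathfrak C_n$ has dimension $2^n-n-1$, and its distinct facets are exactly those defined (in success coordinates) by the inequalities $$\widehat c_B(D)\ge0\qquad(\varnothing\ne B\subseteq[n]).$$
   Context: $[n]=\{1,\ldots,n\}$. For probability distributions $p_1,\ldots,p_n$ in a simplex $\Delta_m=\{p\in\mathbb R^m:p_j\ge0,\ \sum_jp_j=1\}$ and nonempty $H\subseteq[n]$, the success profile is $D(H)=\max\sum_{i\in H}e_i(p_i)$, the maximum over families $(e_i)_{i\in H}$ of nonnegative affine functions on $\Delta_m$ with $\sum_{i\in H}e_i=1$, and the error profile is $F(H)=|H|-D(H)$; $D(\varnothing)=F(\varnothing)=0$. The classical region $\mathfrak C_n\subseteq\mathbb R^{2^n-n-1}$ is the set of all vectors $(F(H))_{H\subseteq[n],|H|\ge2}$ arising in this way for some $m\ge1$ and some $p_1,\ldots,p_n\in\Delta_m$. Success coordinates are obtained by the affine change $D(H)=|H|-F(H)$; the coordinates for $|H|\le1$ are fixed: $D(\varnothing)=0$, $D(\{i\})=1$.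 *)

theory Defs
  imports "HOL-Analysis.Analysis"
begin

text \<open>
  The number \<open>m\<close> of outcomes is existentially quantified in the definition of the classical
  region, so points of \<open>\<real>\<^sup>m\<close> are functions on \<open>nat\<close> that vanish outside \<open>{1..m}\<close>.
\<close>

definition prob_simplex :: "nat \<Rightarrow> (nat \<Rightarrow> real) set" where
  "prob_simplex m =
     {q. (\<forall>j\<in>{1..m}. 0 \<le> q j) \<and> (\<forall>j. j \<notin> {1..m} \<longrightarrow> q j = 0) \<and> (\<Sum>j=1..m. q j) = 1}"

definition affine_on_simplex :: "nat \<Rightarrow> ((nat \<Rightarrow> real) \<Rightarrow> real) \<Rightarrow> bool" where
  "affine_on_simplex m f \<longleftrightarrow>
     (\<exists>a b. \<forall>q\<in>prob_simplex m. f q = b + (\<Sum>j=1..m. a j * q j))"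

text \<open>Families \<open>(e\<^sub>i)\<close> are only constrained for \<open>i \<in> H\<close> and on the simplex.\<close>

definition measurement :: "nat \<Rightarrow> nat set \<Rightarrow> (nat \<Rightarrow> (nat \<Rightarrow> real) \<Rightarrow> real) \<Rightarrow> bool" where
  "measurement m H e \<longleftrightarrow>
     (\<forall>i\<in>H. affine_on_simplex m (e i) \<and> (\<forall>q\<in>prob_simplex m. 0 \<le> e i q)) \<and>
     (\<forall>q\<in>prob_simplex m. (\<Sum>i\<in>H. e i q) = 1)"

definition success_profile :: "nat \<Rightarrow> (nat \<Rightarrow> nat \<Rightarrow> real) \<Rightarrow> nat set \<Rightarrow> real" where
  "success_profile m p H =
     (if H = {} then 0
      else (GREATEST d. \<exists>e. measurement m H e \<and> d = (\<Sum>i\<in>H. e i (p i))))"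

definition error_profile :: "nat \<Rightarrow> (nat \<Rightarrow> nat \<Rightarrow> real) \<Rightarrow> nat set \<Rightarrow> real" where
  "error_profile m p H = real (card H) - success_profile m p H"

text \<open>
  The space \<open>\<real>\<^sup>N\<close> with \<open>N = 2\<^sup>n - n - 1\<close> is \<open>real ^ 'k\<close>, where \<open>ix\<close> enumerates the coordinate
  labels: it is meant to be a bijection from \<open>'k\<close> onto \<open>{H. H \<subseteq> {1..n} \<and> 2 \<le> card H}\<close>.
\<close>

definition classical_region :: "nat \<Rightarrow> ('k::finite \<Rightarrow> nat set) \<Rightarrow> (real ^ 'k) set" where
  "classical_region n ix =
     {x. \<exists>m\<ge>1. \<exists>p. (\<forall>i\<in>{1..n}. p i \<in> prob_simplex m) \<and>
                   (\<forall>k. x $ k = error_profile m p (ix k))}"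

text \<open>
  Success coordinates of a point given in error coordinates. For \<open>card H \<le> 1\<close> they are fixed,
  with value \<open>0\<close> on the empty set and \<open>1\<close> on singletons.
\<close>

definition success_coords :: "('k::finite \<Rightarrow> nat set) \<Rightarrow> real ^ 'k \<Rightarrow> nat set \<Rightarrow> real" where
  "success_coords ix x H =
     (if 2 \<le> card H then real (card H) - x $ (inv ix H) else real (card H))"

definition chat :: "nat \<Rightarrow> (nat set \<Rightarrow> real) \<Rightarrow> nat set \<Rightarrow> real" where
  "chat n D B = - (\<Sum>A\<in>Pow B. (-1) ^ (card B - card A) * D ({1..n} - A))"

definition coverage_coeffs :: "nat \<Rightarrow> (nat set \<Rightarrow> real) \<Rightarrow> (nat set \<Rightarrow> real) \<Rightarrow> bool" where
  "coverage_coeffs n D c \<longleftrightarrow>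
     (\<forall>H\<subseteq>{1..n}. D H = (\<Sum>B | B \<subseteq> {1..n} \<and> B \<inter> H \<noteq> {}. c B)) \<and>
     (\<forall>i\<in>{1..n}. (\<Sum>B | B \<subseteq> {1..n} \<and> i \<in> B. c B) = 1)"

end

theory Submission
  imports Defs
begin

text \<open>
  An optimal measurement guesses, for each outcome \<open>j\<close>, an index \<open>i \<in> H\<close> maximising \<open>p\<^sub>i j\<close>, so
  \<open>D H = (\<Sum>j. max\<^bsub>i\<in>H\<^esub> p\<^sub>i j)\<close>. Each maximum is a nonnegative combination of the functions
  \<open>H \<mapsto> [B \<inter> H \<noteq> {}]\<close> by a layer-cake decomposition, and conversely every nonnegative combination
  with the right values on singletons is realised by outcomes labelled by the sets \<open>B\<close>. Moebius
  inversion identifies the coefficients with \<open>chat\<close>, so the region is the polyhedron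
  \<open>chat \<ge> 0\<close>. It is full-dimensional since constant positive coefficients are feasible, and for
  \<open>n \<ge> 3\<close> any single coefficient can be made negative while the others stay nonnegative, so no
  inequality is redundant.
\<close>

section \<open>Coverage functions and Moebius inversion\<close>

definition coverage :: "nat \<Rightarrow> (nat set \<Rightarrow> real) \<Rightarrow> nat set \<Rightarrow> real" where
  "coverage n c H = (\<Sum>B | B \<subseteq> {1..n} \<and> B \<inter> H \<noteq> {}. c B)"

lemma coverage_empty [simp]: "coverage n c {} = 0"
  by (simp add: coverage_def)

lemma coverage_singleton: "coverage n c {i} = (\<Sum>B | B \<subseteq> {1..n} \<and> i \<in> B. c B)"
  by (simp add: coverage_def)

lemma coverage_add: "coverage n (\<lambda>B. c B + d B) H = coverage n c H + coverage n d H"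
  by (simp add: coverage_def sum.distrib)

lemma coverage_sum: "coverage n (\<lambda>B. \<Sum>l\<in>L. c l B) H = (\<Sum>l\<in>L. coverage n (c l) H)"
  unfolding coverage_def by (rule sum.swap)

lemma coverage_delta:
  assumes "A \<subseteq> {1..n}"
  shows "coverage n (\<lambda>B. if B = A then r else 0) H = (if A \<inter> H \<noteq> {} then r else 0)"
proof -
  have "finite {B. B \<subseteq> {1..n} \<and> B \<inter> H \<noteq> {}}"
    by (rule finite_subset[of _ "Pow {1..n}"]) auto
  then show ?thesis
    using assms by (simp add: coverage_def)
qed

text \<open>A set misses the complement of \<open>A\<close> exactly when it lies inside
  \<open>A\<close>. Complementing thus turns coverage into a constant minus a sum over subsets, the
  form to which Moebius inversion applies.\<close>

lemma coverage_Diff: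
  assumes "A \<subseteq> {1..n}"
  shows "coverage n c ({1..n} - A) = sum c (Pow {1..n}) - sum c (Pow A)"
proof -
  have "{B. B \<subseteq> {1..n} \<and> B \<inter> ({1..n} - A) \<noteq> {}} = Pow {1..n} - Pow A"
    by blast
  then show ?thesis
    using assms by (simp add: coverage_def sum_diff Pow_mono)
qed

text \<open>This gives uniqueness of the coefficients: inverting the subset sums returns
  \<open>c B\<close>, and the minus sign in \<open>chat\<close> undoes the one in front of the
  subset sum.\<close>

lemma chat_coverage:
  assumes D: "\<And>H. H \<subseteq> {1..n} \<Longrightarrow> D H = coverage n c H" and B: "B \<noteq> {}" "B \<subseteq> {1..n}"
  shows "chat n D B = c B"
proof -
  define K where "K = sum c (Pow {1..n})"
  have fin: "finite B"
    using B finite_subset by blast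
  \<comment> \<open>A constant is the subset-sum transform of a function supported at the empty set,
    so its inversion vanishes at every nonempty \<open>B\<close>.\<close>
  have "(if B = {} then K else 0) = (\<Sum>T\<in>Pow B. (-1) ^ (card B - card T) * K)"
    by (rule inclusion_exclusion_mobius[OF _ fin, where g = "\<lambda>_. K" and f = "\<lambda>T. if T = {} then K else 0"])
       auto
  then have K: "(\<Sum>T\<in>Pow B. (-1) ^ (card B - card T) * K) = 0"
    using B by simp
  have c: "c B = (\<Sum>T\<in>Pow B. (-1) ^ (card B - card T) * sum c (Pow T))"
    by (rule inclusion_exclusion_mobius[OF _ fin]) simp
  have "(\<Sum>T\<in>Pow B. (-1) ^ (card B - card T) * D ({1..n} - T))
      = (\<Sum>T\<in>Pow B. (-1) ^ (card B - card T) * K - (-1) ^ (card B - card T) * sum c (Pow T))"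
  proof (intro sum.cong refl)
    fix T assume "T \<in> Pow B"
    then have "D ({1..n} - T) = K - sum c (Pow T)"
      using B coverage_Diff[of T n c] by (simp add: D K_def subset_trans[of T B])
    then show "(-1) ^ (card B - card T) * D ({1..n} - T)
        = (-1) ^ (card B - card T) * K - (-1) ^ (card B - card T) * sum c (Pow T)"
      by (simp only: right_diff_distrib)
  qed
  also have "\<dots> = - c B"
    by (simp add: sum_subtractf K flip: c)
  finally show ?thesis
    by (simp add: chat_def)
qed

text \<open>This gives existence of the coefficients. By inversion the subset sums of
  \<open>chat\<close> are values of \<open>-D\<close> at complements, and \<open>D {} = 0\<close>
  removes the total sum.\<close>

lemma coverage_chat:
  assumes "D {} = 0" "H \<subseteq> {1..n}"
  shows "coverage n (chat n D) H = D H"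
proof -
  have sum_chat: "sum (chat n D) (Pow A) = - D ({1..n} - A)" if "A \<subseteq> {1..n}" for A
  proof -
    \<comment> \<open>With the sign split into a part for \<open>B\<close> and a part for
      \<open>T\<close>, \<open>chat\<close> becomes a signed transform of \<open>D\<close>, and that
      transform is its own inverse.\<close>
    define g where "g S = (\<Sum>T\<in>Pow S. (-1) ^ card T * D ({1..n} - T))" for S
    have fin: "finite A"
      using that finite_subset by blast
    have "chat n D B = - ((-1) ^ card B * g B)" if "B \<subseteq> A" for B
    proof -
      have "finite B"
        using that fin finite_subset by blast
      then have "(-1::real) ^ (card B - card T) = (-1) ^ card B * (-1) ^ card T" if "T \<subseteq> B" for T
        using that by (simp add: card_mono flip: neg_one_power_add_eq_neg_one_power_diff power_add)
      then show ?thesis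
        by (simp add: chat_def g_def sum_distrib_left mult.assoc)
    qed
    then have "sum (chat n D) (Pow A) = - (\<Sum>B\<in>Pow A. (-1) ^ card B * g B)"
      by (simp add: sum_negf)
    also have "(\<Sum>B\<in>Pow A. (-1) ^ card B * g B) = D ({1..n} - A)"
      by (rule inclusion_exclusion_symmetric[symmetric]) (simp_all add: g_def fin)
    finally show ?thesis .
  qed
  have "{1..n} - ({1..n} - H) = H"
    using assms by blast
  then show ?thesis
    using coverage_Diff[of "{1..n} - H" n "chat n D"] sum_chat[of "{1..n}"] sum_chat[of "{1..n} - H"] assms
    by (simp del: One_nat_def)
qed

lemma coverage_cong:
  "(\<And>B. B \<noteq> {} \<Longrightarrow> B \<subseteq> {1..n} \<Longrightarrow> c B = d B) \<Longrightarrow> coverage n c H = coverage n d H"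
  unfolding coverage_def by (rule sum.cong) auto

lemma coverage_coeffs_iff_chat:
  assumes "D {} = 0" "\<And>i. i \<in> {1..n} \<Longrightarrow> D {i} = 1"
  shows "coverage_coeffs n D c \<longleftrightarrow> (\<forall>B. B \<noteq> {} \<and> B \<subseteq> {1..n} \<longrightarrow> c B = chat n D B)"
proof
  assume "coverage_coeffs n D c"
  then have "D H = coverage n c H" if "H \<subseteq> {1..n}" for H
    using that by (simp add: coverage_coeffs_def coverage_def)
  from chat_coverage[OF this] show "\<forall>B. B \<noteq> {} \<and> B \<subseteq> {1..n} \<longrightarrow> c B = chat n D B"
    by simp
next
  assume "\<forall>B. B \<noteq> {} \<and> B \<subseteq> {1..n} \<longrightarrow> c B = chat n D B"
  then have *: "coverage n c H = D H" if "H \<subseteq> {1..n}" for H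
    using coverage_chat[of D H n] coverage_cong[of n c "chat n D" H] assms(1) that by simp
  have "coverage n c {i} = 1" if "i \<in> {1..n}" for i
    using *[of "{i}"] assms(2) that by simp
  with * show "coverage_coeffs n D c"
    by (simp add: coverage_coeffs_def coverage_def)
qed

section \<open>Success profiles as nonnegative coverage functions\<close>

lemma success_profile_eq_sum_Max:
  assumes H: "finite H" "H \<noteq> {}" and p: "\<And>i. i \<in> H \<Longrightarrow> p i \<in> prob_simplex m"
  shows "success_profile m p H = (\<Sum>j=1..m. Max ((\<lambda>i. p i j) ` H))"
proof -
  define M where "M j = Max ((\<lambda>i. p i j) ` H)" for j
  have le_M: "p i j \<le> M j" if "i \<in> H" for i j
    using that H by (simp add: M_def)
  have "\<exists>i\<in>H. p i j = M j" for j
    using Max_in[of "(\<lambda>i. p i j) ` H"] H by (fastforce simp: M_def)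
  \<comment> \<open>\<open>s\<close> is a deterministic maximum-likelihood rule: on outcome
    \<open>j\<close> it guesses an index whose distribution gives \<open>j\<close> the largest
    mass.\<close>
  then obtain s where s: "\<And>j. s j \<in> H" "\<And>j. p (s j) j = M j"
    by metis
  define e where "e i q = (\<Sum>j=1..m. (if s j = i then 1 else 0) * q j)" for i and q :: "nat \<Rightarrow> real"
  have swap: "(\<Sum>i\<in>H. e i (f i)) = (\<Sum>j=1..m. f (s j) j)" for f
  proof -
    have "(\<Sum>i\<in>H. e i (f i)) = (\<Sum>j=1..m. \<Sum>i\<in>H. if s j = i then f i j else 0)"
      unfolding e_def by (subst sum.swap) (simp add: if_distrib[of "\<lambda>t. t * _"] cong: if_cong)
    then show ?thesis
      using H s by simp
  qed
  have "affine_on_simplex m (e i)" for i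
    unfolding affine_on_simplex_def e_def
    by (rule exI[of _ "\<lambda>j. if s j = i then 1 else 0"], rule exI[of _ 0]) simp
  then have e: "measurement m H e"
    unfolding measurement_def using swap[of "\<lambda>_. q" for q]
    by (auto simp: prob_simplex_def e_def intro!: sum_nonneg)
  have bound: "(\<Sum>i\<in>H. f i (p i)) \<le> (\<Sum>j=1..m. M j)" if f: "measurement m H f" for f
  proof -
    \<comment> \<open>The \<open>d j\<close> are the vertices of the simplex. An affine function
      there is determined by its vertex values, so a measurement amounts to a stochastic matrix of
      guesses.\<close>
    define d :: "nat \<Rightarrow> nat \<Rightarrow> real" where "d j = (\<lambda>l. if l = j then 1 else 0)" for j
    have d: "d j \<in> prob_simplex m" if "j \<in> {1..m}" for j
      using that by (auto simp: prob_simplex_def d_def)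
    have lin: "f i q = (\<Sum>j=1..m. f i (d j) * q j)" if i: "i \<in> H" and q: "q \<in> prob_simplex m" for i q
    proof -
      from f i obtain a b where ab: "\<And>q. q \<in> prob_simplex m \<Longrightarrow> f i q = b + (\<Sum>j=1..m. a j * q j)"
        by (auto simp: measurement_def affine_on_simplex_def)
      have "f i (d j) = b + a j" if "j \<in> {1..m}" for j
        using that ab[OF d[OF that]] by (simp add: d_def if_distrib[of "\<lambda>t. _ * t"] cong: if_cong)
      \<comment> \<open>The constant term \<open>b\<close> can be absorbed into the vertex values
        because the entries of \<open>q\<close> sum to one.\<close>
      then have "(\<Sum>j=1..m. f i (d j) * q j) = b * (\<Sum>j=1..m. q j) + (\<Sum>j=1..m. a j * q j)"
        by (simp add: distrib_right sum.distrib sum_distrib_left)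
      then show ?thesis
        using q ab[OF q] by (simp add: prob_simplex_def)
    qed
    have "(\<Sum>i\<in>H. f i (p i)) = (\<Sum>i\<in>H. \<Sum>j=1..m. f i (d j) * p i j)"
      using lin p by (intro sum.cong) auto
    also have "\<dots> \<le> (\<Sum>i\<in>H. \<Sum>j=1..m. f i (d j) * M j)"
      using f d by (intro sum_mono mult_left_mono le_M) (auto simp: measurement_def)
    also have "\<dots> = (\<Sum>j=1..m. (\<Sum>i\<in>H. f i (d j)) * M j)"
      by (subst sum.swap) (simp add: sum_distrib_right)
    also have "\<dots> = (\<Sum>j=1..m. M j)"
      using f d by (intro sum.cong) (auto simp: measurement_def)
    finally show ?thesis .
  qed
  have "(GREATEST d. \<exists>e. measurement m H e \<and> d = (\<Sum>i\<in>H. e i (p i))) = (\<Sum>j=1..m. M j)"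
    using e swap[of p] s bound by (intro Greatest_equality) (auto intro!: exI[of _ e])
  then show ?thesis
    using H by (simp add: success_profile_def M_def)
qed

text \<open>Layer-cake decomposition: peel off the smallest positive value of \<open>w\<close> on its support.\<close>

lemma Max_image_eq_coverage:
  fixes w :: "nat \<Rightarrow> real"
  assumes "\<And>i. i \<in> {1..n} \<Longrightarrow> 0 \<le> w i"
  shows "\<exists>c. (\<forall>B. 0 \<le> c B) \<and> (\<forall>H. H \<noteq> {} \<longrightarrow> H \<subseteq> {1..n} \<longrightarrow> Max (w ` H) = coverage n c H)"
  using assms
proof (induction "card {i \<in> {1..n}. 0 < w i}" arbitrary: w rule: less_induct)
  case less
  define S where "S = {i \<in> {1..n}. 0 < w i}"
  show ?case
  proof (cases "S = {}")
    case True
    have "Max (w ` H) = 0" if "H \<noteq> {}" "H \<subseteq> {1..n}" for H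
    proof -
      have "w i = 0" if "i \<in> H" for i
        using True less.prems[of i] \<open>H \<subseteq> {1..n}\<close> that by (force simp: S_def)
      then have "w ` H = {0}"
        using that by auto
      then show ?thesis
        by simp
    qed
    then show ?thesis
      by (intro exI[of _ "\<lambda>_. 0"]) (simp add: coverage_def)
  next
    case False
    have S: "finite S" "S \<subseteq> {1..n}"
      by (auto simp: S_def)
    define t where "t = Min (w ` S)"
    have t_le: "t \<le> w i" if "i \<in> S" for i
      using S that by (simp add: t_def)
    have "t \<in> w ` S"
      unfolding t_def using S False by (intro Min_in) auto
    then obtain i0 where i0: "i0 \<in> S" "w i0 = t"
      by auto
    then have "0 < t"
      by (auto simp: S_def)
    define v where "v i = (if i \<in> S then w i - t else w i)" for i
    have w0: "w i = 0" if "i \<in> {1..n}" "i \<notin> S" for i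
      using that less.prems[of i] by (auto simp: S_def)
    have v: "0 \<le> v i" if "i \<in> {1..n}" for i
      using that t_le less.prems by (simp add: v_def)
    have "{i \<in> {1..n}. 0 < v i} \<subset> S"
    proof
      show "{i \<in> {1..n}. 0 < v i} \<subseteq> S"
        using \<open>0 < t\<close> by (auto simp: v_def S_def split: if_splits)
      \<comment> \<open>The index \<open>i0\<close> attains the minimum \<open>t\<close>, so
        subtracting \<open>t\<close> drops it from the support; this makes the induction on support
        size decrease.\<close>
      show "{i \<in> {1..n}. 0 < v i} \<noteq> S"
      proof -
        have "i0 \<notin> {i \<in> {1..n}. 0 < v i}"
          using i0 by (simp add: v_def)
        then show ?thesis
          using i0(1) by metis
      qed
    qed
    then have "card {i \<in> {1..n}. 0 < v i} < card {i \<in> {1..n}. 0 < w i}"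
      using S unfolding S_def[symmetric] by (intro psubset_card_mono) auto
    from less.hyps[OF this v] obtain c where c: "\<And>B. 0 \<le> c B"
      "\<And>H. H \<noteq> {} \<Longrightarrow> H \<subseteq> {1..n} \<Longrightarrow> Max (v ` H) = coverage n c H"
      by blast
    define c' where "c' B = c B + (if B = S then t else 0)" for B
    have "Max (w ` H) = coverage n c' H" if H: "H \<noteq> {}" "H \<subseteq> {1..n}" for H
    proof -
      have fin: "finite H"
        using H finite_subset by blast
      have cov: "coverage n c' H = coverage n c H + (if S \<inter> H \<noteq> {} then t else 0)"
        using S by (simp only: c'_def[abs_def] coverage_add coverage_delta)
      have "v i \<le> Max (v ` H)" if "i \<in> H" for i
        using fin that by simp
      moreover have "Max (v ` H) \<in> v ` H"
        using fin H by (intro Max_in) auto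
      then obtain k where k: "k \<in> H" "v k = Max (v ` H)"
        by auto
      ultimately have vk: "\<And>i. i \<in> H \<Longrightarrow> v i \<le> v k"
        by simp
      \<comment> \<open>Peeling lowers the maximum over \<open>H\<close> by exactly \<open>t\<close>
        if \<open>H\<close> meets the support, and otherwise both maxima are zero. This is the
        contribution of the new coefficient at \<open>S\<close>.\<close>
      have "Max (w ` H) = v k + (if S \<inter> H \<noteq> {} then t else 0)"
      proof (cases "S \<inter> H = {}")
        case True
        have "w i = 0" "v i = 0" if "i \<in> H" for i
        proof -
          have "i \<in> {1..n}" "i \<notin> S"
            using that H True by blast+
          then show "w i = 0" "v i = 0"
            using w0 by (simp_all add: v_def)
        qed
        then have "w ` H = {0}" "v k = 0"
          using k by auto
        then show ?thesis
          using True by simp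
      next
        case meet: False
        have le: "w i \<le> v k + t" if "i \<in> H" for i
          using vk[OF that] \<open>0 < t\<close> by (auto simp: v_def split: if_splits)
        have "\<exists>i\<in>H. w i = v k + t"
        proof (cases "k \<in> S")
          case True
          then show ?thesis
            using k(1) by (intro bexI[of _ k]) (simp_all add: v_def)
        next
          case False
          \<comment> \<open>Here the maximum of \<open>v\<close> over \<open>H\<close> is zero, so
            any index of \<open>H\<close> in the support has \<open>w\<close>-value exactly
            \<open>t\<close>.\<close>
          then have "v k = 0"
            using k(1) H w0[of k] by (auto simp: v_def)
          obtain i where i: "i \<in> S" "i \<in> H"
            using meet by blast
          then have "v i = 0"
            using vk[of i] v[of i] \<open>v k = 0\<close> H by fastforce
          then show ?thesis
            using i \<open>v k = 0\<close> by (intro bexI[of _ i]) (simp_all add: v_def)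
        qed
        then have "v k + t \<in> w ` H"
          by (metis image_eqI)
        then have "Max (w ` H) = v k + t"
          using le fin by (intro Max_eqI) auto
        then show ?thesis
          using meet by simp
      qed
      then show ?thesis
        using cov c(2)[OF H] k by simp
    qed
    moreover have "0 \<le> c' B" for B
      using c(1)[of B] \<open>0 < t\<close> by (simp add: c'_def)
    ultimately show ?thesis
      by blast
  qed
qed

text \<open>The layer-cake decomposition is applied to each outcome separately; coverage is linear
  in its coefficients, so the decompositions add up.\<close>

lemma success_profile_eq_coverage:
  assumes p: "\<And>i. i \<in> {1..n} \<Longrightarrow> p i \<in> prob_simplex m"
  shows "\<exists>c. (\<forall>B. 0 \<le> c B) \<and> (\<forall>H. H \<subseteq> {1..n} \<longrightarrow> success_profile m p H = coverage n c H)"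
proof -
  have "\<forall>j\<in>{1..m}. \<exists>c. (\<forall>B. 0 \<le> c B) \<and>
      (\<forall>H. H \<noteq> {} \<longrightarrow> H \<subseteq> {1..n} \<longrightarrow> Max ((\<lambda>i. p i j) ` H) = coverage n c H)"
    using p by (intro ballI Max_image_eq_coverage) (auto simp: prob_simplex_def)
  then obtain c where *: "\<forall>j\<in>{1..m}. (\<forall>B. 0 \<le> c j B) \<and>
      (\<forall>H. H \<noteq> {} \<longrightarrow> H \<subseteq> {1..n} \<longrightarrow> Max ((\<lambda>i. p i j) ` H) = coverage n (c j) H)"
    by (rule bchoice[THEN exE])
  have c: "0 \<le> c j B" if "j \<in> {1..m}" for j B
    using * that by simp
  have Max_eq: "Max ((\<lambda>i. p i j) ` H) = coverage n (c j) H"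
    if "j \<in> {1..m}" "H \<noteq> {}" "H \<subseteq> {1..n}" for j H
    using * that by simp
  define d where "d B = (\<Sum>j=1..m. c j B)" for B
  have "success_profile m p H = coverage n d H" if H: "H \<subseteq> {1..n}" for H
  proof (cases "H = {}")
    case True
    then show ?thesis
      by (simp add: success_profile_def)
  next
    case False
    have "success_profile m p H = (\<Sum>j=1..m. Max ((\<lambda>i. p i j) ` H))"
      using False H p finite_subset[OF H] by (intro success_profile_eq_sum_Max) auto
    also have "\<dots> = (\<Sum>j=1..m. coverage n (c j) H)"
      using False H by (intro sum.cong refl Max_eq)
    also have "\<dots> = coverage n d H"
      by (simp only: d_def[abs_def] coverage_sum)
    finally show ?thesis .
  qed
  moreover have "0 \<le> d B" for B
    unfolding d_def by (intro sum_nonneg c)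
  ultimately show ?thesis
    by blast
qed

text \<open>One outcome for each nonempty \<open>B\<close>; row \<open>i\<close> puts mass \<open>c B\<close> on every \<open>B\<close> containing \<open>i\<close>.\<close>

lemma coverage_eq_success_profile:
  assumes "1 \<le> n" and nonneg: "\<And>B. B \<noteq> {} \<Longrightarrow> B \<subseteq> {1..n} \<Longrightarrow> 0 \<le> c B"
    and one: "\<And>i. i \<in> {1..n} \<Longrightarrow> coverage n c {i} = 1"
  shows "\<exists>m\<ge>1. \<exists>p. (\<forall>i\<in>{1..n}. p i \<in> prob_simplex m) \<and>
    (\<forall>H. H \<subseteq> {1..n} \<longrightarrow> success_profile m p H = coverage n c H)"
proof -
  define Bs where "Bs = {B. B \<noteq> {} \<and> B \<subseteq> {1..n}}"
  have fin: "finite Bs"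
    by (rule finite_subset[of _ "Pow {1..n}"]) (auto simp: Bs_def)
  \<comment> \<open>A nonempty index set of outcomes is needed to obtain
    \<open>m \<ge> 1\<close>.\<close>
  have "{1} \<in> Bs"
    using assms(1) by (auto simp: Bs_def)
  then have m: "1 \<le> card Bs"
    using fin card_gt_0_iff[of Bs] by fastforce
  obtain h where h: "bij_betw h {1..card Bs} Bs"
    using ex_bij_betw_nat_finite_1[OF fin] by blast
  define p where "p i j = (if j \<in> {1..card Bs} \<and> i \<in> h j then c (h j) else 0)" for i j
  have h_in: "h j \<in> Bs" if "j \<in> {1..card Bs}" for j
    using bij_betwE[OF h] that by blast
  have cov: "coverage n c H = (\<Sum>j=1..card Bs. if h j \<inter> H \<noteq> {} then c (h j) else 0)" for H
  proof -
    have "{B. B \<subseteq> {1..n} \<and> B \<inter> H \<noteq> {}} = {B \<in> Bs. B \<inter> H \<noteq> {}}"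
      by (auto simp: Bs_def)
    then have "coverage n c H = (\<Sum>B\<in>Bs. if B \<inter> H \<noteq> {} then c B else 0)"
      unfolding coverage_def using fin by (simp only: sum.inter_filter)
    then show ?thesis
      by (simp only: sum.reindex_bij_betw[OF h, symmetric])
  qed
  have p: "p i \<in> prob_simplex (card Bs)" if "i \<in> {1..n}" for i
  proof -
    have "(\<Sum>j=1..card Bs. p i j) = coverage n c {i}"
      unfolding cov by (intro sum.cong) (auto simp: p_def)
    then show ?thesis
      using one[OF that] h_in nonneg by (auto simp: prob_simplex_def p_def Bs_def)
  qed
  have "success_profile (card Bs) p H = coverage n c H" if H: "H \<subseteq> {1..n}" for H
  proof (cases "H = {}")
    case True
    then show ?thesis
      by (simp add: success_profile_def)
  next
    case False
    have fH: "finite H"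
      using H finite_subset by blast
    \<comment> \<open>On \<open>H\<close>, column \<open>j\<close> takes only the values
      \<open>c (h j)\<close> and 0; by nonnegativity the former is the maximum as soon as it
      occurs.\<close>
    have "Max ((\<lambda>i. p i j) ` H) = (if h j \<inter> H \<noteq> {} then c (h j) else 0)" if j: "j \<in> {1..card Bs}" for j
    proof (rule Max_eqI)
      have "0 \<le> c (h j)"
        using h_in[OF j] nonneg by (simp add: Bs_def)
      then show "y \<le> (if h j \<inter> H \<noteq> {} then c (h j) else 0)" if "y \<in> (\<lambda>i. p i j) ` H" for y
        using that by (auto simp: p_def)
      show "(if h j \<inter> H \<noteq> {} then c (h j) else 0) \<in> (\<lambda>i. p i j) ` H"
        using False j by (auto simp: p_def image_iff)
    qed (use fH in simp)
    then have "(\<Sum>j=1..card Bs. Max ((\<lambda>i. p i j) ` H)) = coverage n c H"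
      unfolding cov by (intro sum.cong) auto
    moreover have "p i \<in> prob_simplex (card Bs)" if "i \<in> H" for i
      using that H p by blast
    ultimately show ?thesis
      using success_profile_eq_sum_Max[OF fH False, of p "card Bs"] by simp
  qed
  with m p show ?thesis
    by blast
qed

section \<open>The region in error coordinates and its inequality description\<close>

definition point_of_coeffs :: "nat \<Rightarrow> ('k::finite \<Rightarrow> nat set) \<Rightarrow> (nat set \<Rightarrow> real) \<Rightarrow> real ^ 'k" where
  "point_of_coeffs n ix c = (\<chi> k. real (card (ix k)) - coverage n c (ix k))"

context
  fixes n :: nat and ix :: "'k::finite \<Rightarrow> nat set"
  assumes ix: "bij_betw ix UNIV {H. H \<subseteq> {1..n} \<and> 2 \<le> card H}"
begin

lemma ix_inv: "H \<subseteq> {1..n} \<Longrightarrow> 2 \<le> card H \<Longrightarrow> ix (inv ix H) = H"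
  using bij_betw_inv_into_right[OF ix] by simp

lemma inv_ix: "inv ix (ix k) = k"
  using ix by (simp add: bij_betw_def)

lemma ix_subset: "ix k \<subseteq> {1..n}" and card_ix: "2 \<le> card (ix k)"
  using bij_betwE[OF ix] by auto

text \<open>Coordinates exist only for sets of size at least two; the normalisation of
  \<open>D\<close> settles the empty set and the singletons.\<close>

lemma success_coords_eqI:
  assumes "D {} = 0" "\<And>i. i \<in> {1..n} \<Longrightarrow> D {i} = 1"
    and x: "\<And>k. x $ k = real (card (ix k)) - D (ix k)" and H: "H \<subseteq> {1..n}"
  shows "success_coords ix x H = D H"
proof -
  have fin: "finite H"
    using H finite_subset by blast
  consider "2 \<le> card H" | "card H = 0" | "card H = 1"
    by linarith
  then show ?thesis
  proof cases
    case 1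
    then show ?thesis
      using H by (simp add: success_coords_def x ix_inv)
  next
    case 2
    then show ?thesis
      using fin assms by (simp add: success_coords_def)
  next
    case 3
    then obtain i where "H = {i}"
      using card_1_singletonE by blast
    then show ?thesis
      using H assms by (simp add: success_coords_def)
  qed
qed

text \<open>Points with prescribed \<open>chat\<close> values can thus be built by choosing
  coefficients freely, subject only to the singleton normalisation.\<close>

lemma chat_point_of_coeffs:
  assumes "\<And>i. i \<in> {1..n} \<Longrightarrow> coverage n c {i} = 1" "B \<noteq> {}" "B \<subseteq> {1..n}"
  shows "chat n (success_coords ix (point_of_coeffs n ix c)) B = c B"
  using assms
  by (intro chat_coverage success_coords_eqI) (auto simp: point_of_coeffs_def)

lemma classical_region_eq:
  assumes "1 \<le> n"
  shows "classical_region n ix =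
    {x. \<forall>B. B \<noteq> {} \<and> B \<subseteq> {1..n} \<longrightarrow> 0 \<le> chat n (success_coords ix x) B}"
proof (intro set_eqI iffI CollectI allI impI; (elim CollectE)?)
  fix x B assume x: "x \<in> classical_region n ix" and B: "B \<noteq> {} \<and> B \<subseteq> {1..n}"
  then obtain m p where p: "\<And>i. i \<in> {1..n} \<Longrightarrow> p i \<in> prob_simplex m"
    and xk: "\<And>k. x $ k = error_profile m p (ix k)"
    unfolding classical_region_def by blast
  have "\<exists>c. (\<forall>B. 0 \<le> c B) \<and> (\<forall>H. H \<subseteq> {1..n} \<longrightarrow> success_profile m p H = coverage n c H)"
    using p by (rule success_profile_eq_coverage)
  then obtain c where nonneg: "\<forall>B. 0 \<le> c B"
    and cov: "\<forall>H. H \<subseteq> {1..n} \<longrightarrow> success_profile m p H = coverage n c H"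
    by (elim exE conjE)
  \<comment> \<open>Over a singleton the maxima are just the entries of \<open>p i\<close>, which
    sum to one.\<close>
  have "coverage n c {i} = 1" if "i \<in> {1..n}" for i
  proof -
    have "success_profile m p {i} = (\<Sum>j=1..m. Max ((\<lambda>i. p i j) ` {i}))"
      using p[OF that] by (intro success_profile_eq_sum_Max) auto
    then show ?thesis
      using p[OF that] cov[rule_format, of "{i}"] that by (simp add: prob_simplex_def)
  qed
  then have "success_coords ix x H = coverage n c H" if "H \<subseteq> {1..n}" for H
    using that cov ix_subset by (intro success_coords_eqI) (simp_all add: xk error_profile_def)
  from chat_coverage[OF this] B nonneg show "0 \<le> chat n (success_coords ix x) B"
    by simp
next
  fix x assume x: "\<forall>B. B \<noteq> {} \<and> B \<subseteq> {1..n} \<longrightarrow> 0 \<le> chat n (success_coords ix x) B"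
  define c where "c = chat n (success_coords ix x)"
  have cov: "coverage n c H = success_coords ix x H" if "H \<subseteq> {1..n}" for H
    unfolding c_def using that by (intro coverage_chat) (auto simp: success_coords_def)
  have "coverage n c {i} = 1" if "i \<in> {1..n}" for i
    using that cov[of "{i}"] by (simp add: success_coords_def)
  then obtain m p where "1 \<le> m" "\<forall>i\<in>{1..n}. p i \<in> prob_simplex m"
    and D: "\<And>H. H \<subseteq> {1..n} \<Longrightarrow> success_profile m p H = coverage n c H"
    using coverage_eq_success_profile[of n c] assms x by (auto simp: c_def)
  moreover have "x $ k = error_profile m p (ix k)" for k
    using D[OF ix_subset] cov[OF ix_subset] card_ix[of k]
    by (simp add: error_profile_def success_coords_def inv_ix)
  ultimately show "x \<in> classical_region n ix"
    by (auto simp: classical_region_def)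
qed

text \<open>The count is taken over the integers to match \<open>aff_dim\<close> and to avoid
  truncated subtraction.\<close>

lemma card_index: "int CARD('k) = 2 ^ n - int n - 1"
proof -
  define T where "T = insert {} ((\<lambda>i. {i}) ` {1..n})"
  have T: "H \<notin> T \<longleftrightarrow> 2 \<le> card H" if "H \<subseteq> {1..n}" for H
  proof
    assume "H \<notin> T"
    then have "card H \<noteq> 0" "card H \<noteq> 1"
      using that finite_subset[OF that] by (auto simp: T_def card_1_singleton_iff)
    then show "2 \<le> card H"
      by linarith
  qed (auto simp: T_def)
  have "{H. H \<subseteq> {1..n} \<and> 2 \<le> card H} = Pow {1..n} - T"
    using T by blast
  moreover have "card T = Suc n"
    unfolding T_def by (subst card_insert_disjoint) (auto simp: card_image)
  moreover have "card (Pow {1..n} - T) = card (Pow {1..n}) - card T"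
    by (rule card_Diff_subset) (auto simp: T_def)
  ultimately have "CARD('k) = 2 ^ n - Suc n"
    using bij_betw_same_card[OF ix] by (simp add: card_Pow)
  moreover have "Suc n \<le> 2 ^ n"
    by (simp add: Suc_le_eq)
  ultimately show ?thesis
    by (simp add: of_nat_diff)
qed

section \<open>Strict feasibility and irredundancy of the inequalities\<close>

lemma ex_all_chat_pos:
  assumes "1 \<le> n"
  shows "\<exists>u. \<forall>B. B \<noteq> {} \<and> B \<subseteq> {1..n} \<longrightarrow> 0 < chat n (success_coords ix u) B"
proof -
  \<comment> \<open>Each index lies in \<open>2 ^ (n - 1)\<close> subsets, so this uniform weight is
    the normalised one.\<close>
  define c :: "nat set \<Rightarrow> real" where "c B = 1 / 2 ^ (n - 1)" for B
  have "coverage n c {i} = 1" if "i \<in> {1..n}" for i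
  proof -
    have "{B. B \<subseteq> {1..n} \<and> i \<in> B} = insert i ` Pow ({1..n} - {i})"
    proof (intro set_eqI iffI)
      fix B assume "B \<in> {B. B \<subseteq> {1..n} \<and> i \<in> B}"
      then show "B \<in> insert i ` Pow ({1..n} - {i})"
        by (intro image_eqI[of _ _ "B - {i}"]) auto
    qed (use that in auto)
    moreover have "inj_on (insert i) (Pow ({1..n} - {i}))"
      by (rule inj_onI) blast
    ultimately have "card {B. B \<subseteq> {1..n} \<and> i \<in> B} = 2 ^ (n - 1)"
      using that by (simp add: card_image card_Pow)
    then show ?thesis
      by (simp add: coverage_singleton c_def)
  qed
  then have "chat n (success_coords ix (point_of_coeffs n ix c)) B = c B" if "B \<noteq> {}" "B \<subseteq> {1..n}" for B
    using that by (intro chat_point_of_coeffs)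
  then show ?thesis
    by (intro exI[of _ "point_of_coeffs n ix c"]) (simp add: c_def)
qed

text \<open>
  For \<open>B\<close> with at least two elements, the coefficient \<open>-1\<close> on \<open>B\<close> is compensated on the singletons
  inside \<open>B\<close>; for \<open>B = {i}\<close> it is compensated on two pairs \<open>{i, j}\<close>, \<open>{i, k}\<close>, which is where
  \<open>n \<ge> 3\<close> enters.
\<close>

lemma ex_only_chat_neg:
  assumes n: "3 \<le> n" and B: "B \<noteq> {}" "B \<subseteq> {1..n}"
  shows "\<exists>w. chat n (success_coords ix w) B < 0 \<and>
    (\<forall>C. C \<noteq> {} \<and> C \<subseteq> {1..n} \<and> C \<noteq> B \<longrightarrow> 0 \<le> chat n (success_coords ix w) C)"
proof -
  have "\<exists>c. c B < 0 \<and> (\<forall>C. C \<noteq> B \<longrightarrow> 0 \<le> c C) \<and> (\<forall>i\<in>{1..n}. coverage n c {i} = 1)"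
  proof (cases "\<exists>i. B = {i}")
    case True
    then obtain i where i: "B = {i}"
      by blast
    with B n have "2 \<le> card ({1..n} - {i})"
      by simp
    then obtain S where "S \<subseteq> {1..n} - {i}" "card S = 2"
      by (meson obtain_subset_with_card_n)
    then obtain j k where jk: "j \<in> {1..n}" "k \<in> {1..n}" "j \<noteq> i" "k \<noteq> i" "j \<noteq> k"
      by (auto simp: card_2_iff)
    \<comment> \<open>Row \<open>i\<close> receives -1 + 1 + 1, rows \<open>j\<close> and
      \<open>k\<close> receive 1 from their pair, and every other row receives 1 from its own
      singleton.\<close>
    define c :: "nat set \<Rightarrow> real" where "c C = (if C = {i} then -1 else 0) + (if C = {i, j} then 1 else 0)
      + (if C = {i, k} then 1 else 0) + (\<Sum>l\<in>{1..n} - {i, j, k}. if C = {l} then 1 else 0)" for C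
    have "coverage n c {l} = 1" if "l \<in> {1..n}" for l
    proof -
      have "coverage n c {l} = (if l = i then -1 else 0) + (if l \<in> {i, j} then 1 else 0)
        + (if l \<in> {i, k} then 1 else 0) + (\<Sum>l'\<in>{1..n} - {i, j, k}. if l' = l then 1 else 0)"
        using B i jk by (simp add: c_def[abs_def] coverage_add coverage_sum coverage_delta)
      then show ?thesis
        using that jk by auto
    qed
    moreover have "0 \<le> c C" if "C \<noteq> B" for C
    proof -
      have "0 \<le> (\<Sum>l\<in>{1..n} - {i, j, k}. if C = {l} then 1 else 0 :: real)"
        by (intro sum_nonneg) simp
      then show ?thesis
        using that i by (simp add: c_def)
    qed
    moreover have "c B < 0"
    proof -
      have "(\<Sum>l\<in>{1..n} - {i, j, k}. if B = {l} then 1 else 0 :: real) = 0"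
        using i by (intro sum.neutral) auto
      then show ?thesis
        using i jk by (auto simp: c_def doubleton_eq_iff)
    qed
    ultimately show ?thesis
      by blast
  next
    case False
    \<comment> \<open>A row in \<open>B\<close> receives -1 + 2, any other row receives 1. As
      \<open>B\<close> is not a singleton, no compensating weight falls on \<open>B\<close>
      itself.\<close>
    define c :: "nat set \<Rightarrow> real" where "c C = (if C = B then -1 else 0)
      + (\<Sum>l\<in>{1..n}. if C = {l} then if l \<in> B then 2 else 1 else 0)" for C
    have "coverage n c {l} = 1" if "l \<in> {1..n}" for l
    proof -
      have "coverage n c {l} = (if l \<in> B then -1 else 0)
        + (\<Sum>l'\<in>{1..n}. if l' = l then if l' \<in> B then 2 else 1 else 0)"
        using B by (simp add: c_def[abs_def] coverage_add coverage_sum coverage_delta)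
      then show ?thesis
        using that by simp
    qed
    moreover have "0 \<le> c C" if "C \<noteq> B" for C
    proof -
      have "0 \<le> (\<Sum>l\<in>{1..n}. if C = {l} then if l \<in> B then 2 else 1 else 0 :: real)"
        by (intro sum_nonneg) simp
      then show ?thesis
        using that by (simp add: c_def)
    qed
    moreover have "c B < 0"
    proof -
      have "(\<Sum>l\<in>{1..n}. if B = {l} then if l \<in> B then 2 else 1 else 0 :: real) = 0"
        using False by (intro sum.neutral) auto
      then show ?thesis
        by (simp add: c_def)
    qed
    ultimately show ?thesis
      by blast
  qed
  then obtain c where c: "c B < 0" "\<And>C. C \<noteq> B \<Longrightarrow> 0 \<le> c C" "\<And>i. i \<in> {1..n} \<Longrightarrow> coverage n c {i} = 1"
    by blast
  then show ?thesis
    using B chat_point_of_coeffs[of c]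
    by (intro exI[of _ "point_of_coeffs n ix c"]) auto
qed

end

section \<open>Facets of an irredundant system of linear inequalities\<close>

lemma chat_success_coords_affine:
  fixes ix :: "'k::finite \<Rightarrow> nat set"
  shows "\<exists>a b. \<forall>x. chat n (success_coords ix x) B = b - a \<bullet> x"
proof -
  define s :: "nat set \<Rightarrow> real" where "s A = (-1) ^ (card B - card A)" for A
  \<comment> \<open>Success coordinates of sets of size at most one are constant, hence have zero
    gradient.\<close>
  define v where "v H = (if 2 \<le> card H then axis (inv ix H) 1 else 0 :: real ^ 'k)" for H
  have "success_coords ix x H = real (card H) - v H \<bullet> x" for x H
    by (simp add: success_coords_def v_def inner_commute[of "axis _ _"] inner_axis)
  then have "chat n (success_coords ix x) B =
      - (\<Sum>A\<in>Pow B. s A * card ({1..n} - A)) - (- (\<Sum>A\<in>Pow B. s A *\<^sub>R v ({1..n} - A))) \<bullet> x" for x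
    by (simp add: chat_def s_def right_diff_distrib sum_subtractf inner_sum_left)
  then show ?thesis
    by blast
qed

text \<open>The strictly feasible \<open>u\<close> has an open neighbourhood in \<open>S\<close>,
  which gives full dimension. A point violating only constraint \<open>i\<close> shows that
  \<open>i\<close> cannot be dropped, so the facets of the polyhedron are its constraint faces. Both
  kinds of points together show that these faces differ.\<close>

lemma facets_of_irredundant_system:
  fixes a :: "'b \<Rightarrow> 'a::euclidean_space" and b :: "'b \<Rightarrow> real"
  assumes fin: "finite I" and u: "\<And>i. i \<in> I \<Longrightarrow> a i \<bullet> u < b i"
    and irredundant: "\<And>i. i \<in> I \<Longrightarrow> \<exists>w. b i < a i \<bullet> w \<and> (\<forall>j\<in>I - {i}. a j \<bullet> w \<le> b j)"
  defines "S \<equiv> {x. \<forall>i\<in>I. a i \<bullet> x \<le> b i}"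
  shows "aff_dim S = DIM('a)"
    and "bij_betw (\<lambda>i. {x \<in> S. a i \<bullet> x = b i}) I {G. G facet_of S}"
proof -
  define U where "U = (\<Inter>i\<in>I. {x. a i \<bullet> x < b i})"
  have U: "open U" "u \<in> U" "U \<subseteq> S"
    using fin u by (auto simp: U_def S_def open_halfspace_lt intro!: open_INT) (meson less_imp_le)
  have "aff_dim U = DIM('a)"
    using U by (intro aff_dim_open) auto
  then show "aff_dim S = DIM('a)"
    using aff_dim_subset[OF U(3)] aff_dim_le_DIM[of S] by simp
  have "interior S \<noteq> {}"
    using U interior_maximal by blast
  then have hull: "affine hull S = UNIV"
    by (rule affine_hull_nonempty_interior)
  define h where "h i = {x. a i \<bullet> x \<le> b i}" for i
  obtain w where w: "\<And>i. i \<in> I \<Longrightarrow> b i < a i \<bullet> w i"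
    "\<And>i j. i \<in> I \<Longrightarrow> j \<in> I \<Longrightarrow> j \<noteq> i \<Longrightarrow> a j \<bullet> w i \<le> b j"
    using irredundant by (metis DiffI singletonD)
  have w_h: "w i \<in> h j \<longleftrightarrow> j \<noteq> i" if "i \<in> I" "j \<in> I" for i j
    using w(1)[of i] w(2)[of i j] that by (auto simp: h_def)
  then have inj: "inj_on h I"
    by (metis inj_onI)
  \<comment> \<open>\<open>facet_of_polyhedron_explicit\<close> indexes constraints by half-spaces;
    injectivity of \<open>h\<close> lets \<open>g\<close> recover the index.\<close>
  define g where "g = the_inv_into I h"
  have g: "g (h i) = i" if "i \<in> I" for i
    using the_inv_into_f_f[OF inj that] by (simp add: g_def)
  have "(G facet_of S) \<longleftrightarrow> (\<exists>H. H \<in> h ` I \<and> G = S \<inter> {x. a (g H) \<bullet> x = b (g H)})" for G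
  proof (rule facet_of_polyhedron_explicit)
    show "finite (h ` I)"
      using fin by simp
    show "S = affine hull S \<inter> \<Inter> (h ` I)"
      unfolding hull by (auto simp: S_def h_def)
    show "a (g H) \<noteq> 0 \<and> H = {x. a (g H) \<bullet> x \<le> b (g H)}" if H: "H \<in> h ` I" for H
    proof -
      obtain i where i: "i \<in> I" "H = h i"
        using H by blast
      \<comment> \<open>A zero normal vector would give \<open>u\<close> and \<open>w i\<close> the
        same inner product, yet they lie on opposite sides of \<open>b i\<close>.\<close>
      have "a i \<noteq> 0"
        using u[OF i(1)] w(1)[OF i(1)] by auto
      then show ?thesis
        using i g by (simp add: h_def)
    qed
    show "S \<subset> affine hull S \<inter> \<Inter> F'" if F': "F' \<subset> h ` I" for F'
    proof -
      obtain i where i: "i \<in> I" "h i \<notin> F'"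
        using F' by blast
      have "w i \<in> \<Inter> F'"
        using F' i w_h by blast
      moreover have "w i \<notin> S"
        using w(1)[OF i(1)] i by (force simp: S_def)
      moreover have "S \<subseteq> \<Inter> F'"
        using F' by (auto simp: S_def h_def)
      ultimately show ?thesis
        unfolding hull by blast
    qed
  qed
  then have facets: "{G. G facet_of S} = (\<lambda>i. {x \<in> S. a i \<bullet> x = b i}) ` I"
    using g by auto
  have "i = j" if ij: "i \<in> I" "j \<in> I" and eq: "{x \<in> S. a i \<bullet> x = b i} = {x \<in> S. a j \<bullet> x = b j}" for i j
  proof (rule ccontr)
    assume "i \<noteq> j"
    \<comment> \<open>The segment from \<open>u\<close> to \<open>w i\<close> leaves \<open>S\<close> through the \<open>i\<close>-th face only.\<close>
    define t where "t = (b i - a i \<bullet> u) / (a i \<bullet> w i - a i \<bullet> u)"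
    define y where "y = (1 - t) *\<^sub>R u + t *\<^sub>R w i"
    have t: "0 \<le> t" "t < 1"
      using u[OF ij(1)] w(1)[OF ij(1)] by (simp_all add: t_def)
    have "t * (a i \<bullet> w i - a i \<bullet> u) = b i - a i \<bullet> u"
      using u[OF ij(1)] w(1)[OF ij(1)] by (simp add: t_def)
    then have yi: "a i \<bullet> y = b i"
      by (simp add: y_def inner_add_right algebra_simps)
    have yk: "a k \<bullet> y < b k" if "k \<in> I" "k \<noteq> i" for k
    proof -
      \<comment> \<open>Strictness comes from the positive weight on \<open>u\<close>, since
        \<open>w i\<close> satisfies constraint \<open>k\<close> only weakly.\<close>
      have "(1 - t) * (a k \<bullet> u) < (1 - t) * b k"
        using t u[OF that(1)] by simp
      moreover have "t * (a k \<bullet> w i) \<le> t * b k"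
        using t w(2)[OF ij(1) that] by (intro mult_left_mono)
      ultimately show ?thesis
        by (simp add: y_def inner_add_right algebra_simps)
    qed
    have "y \<in> S"
      using yi yk by (force simp: S_def)
    then have "a j \<bullet> y = b j"
      using yi eq by blast
    then show False
      using yk[OF ij(2)] \<open>i \<noteq> j\<close> by simp
  qed
  then show "bij_betw (\<lambda>i. {x \<in> S. a i \<bullet> x = b i}) I {G. G facet_of S}"
    unfolding facets by (intro inj_on_imp_bij_betw inj_onI)
qed

section \<open>Coefficient formula, dimension and facets combined\<close>

theorem proposition3p3:
  fixes n :: nat and ix :: "'k::finite \<Rightarrow> nat set"
  assumes "2 \<le> n"
    and "bij_betw ix UNIV {H. H \<subseteq> {1..n} \<and> 2 \<le> card H}"
  shows "(\<forall>D :: nat set \<Rightarrow> real. D {} = 0 \<and> (\<forall>i\<in>{1..n}. D {i} = 1) \<longrightarrow>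
            (\<forall>c. coverage_coeffs n D c \<longleftrightarrow>
                 (\<forall>B. B \<noteq> {} \<and> B \<subseteq> {1..n} \<longrightarrow> c B = chat n D B)))
       \<and> (3 \<le> n \<longrightarrow>
            aff_dim (classical_region n ix) = 2 ^ n - int n - 1
          \<and> classical_region n ix =
              {x. \<forall>B. B \<noteq> {} \<and> B \<subseteq> {1..n} \<longrightarrow> 0 \<le> chat n (success_coords ix x) B}
          \<and> bij_betw (\<lambda>B. {x \<in> classical_region n ix. chat n (success_coords ix x) B = 0})
              {B. B \<noteq> {} \<and> B \<subseteq> {1..n}}
              {G. G facet_of classical_region n ix})"
proof -
  note ix = assms(2)
  define Bs where "Bs = {B. B \<noteq> {} \<and> B \<subseteq> {1..n}}"
  have region: "classical_region n ix = {x. \<forall>B\<in>Bs. 0 \<le> chat n (success_coords ix x) B}"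
    using classical_region_eq[OF ix] assms(1) by (simp add: Bs_def)
  have facets: "aff_dim (classical_region n ix) = 2 ^ n - int n - 1
      \<and> bij_betw (\<lambda>B. {x \<in> classical_region n ix. chat n (success_coords ix x) B = 0}) Bs
          {G. G facet_of classical_region n ix}" if n: "3 \<le> n"
  proof -
    \<comment> \<open>This rewrites each condition \<open>0 \<le> chat\<close> as a half-space
      \<open>a B \<bullet> x \<le> b B\<close>, as the facet lemma requires.\<close>
    obtain a b where ab: "\<And>B x. chat n (success_coords ix x) B = b B - a B \<bullet> x"
      using chat_success_coords_affine[of n ix] by metis
    have fin: "finite Bs"
      by (rule finite_subset[of _ "Pow {1..n}"]) (auto simp: Bs_def)
    obtain u where u: "\<And>B. B \<in> Bs \<Longrightarrow> a B \<bullet> u < b B"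
      using ex_all_chat_pos[OF ix] n by (auto simp: Bs_def ab)
    have w: "\<exists>w. b B < a B \<bullet> w \<and> (\<forall>C\<in>Bs - {B}. a C \<bullet> w \<le> b C)" if B: "B \<in> Bs" for B
    proof -
      have "B \<noteq> {}" "B \<subseteq> {1..n}"
        using B by (simp_all add: Bs_def)
      from ex_only_chat_neg[OF ix n this] show ?thesis
        unfolding ab by (simp add: Bs_def Ball_def conj_assoc del: One_nat_def)
    qed
    from facets_of_irredundant_system[of Bs a u b, OF fin u w] show ?thesis
      using card_index[OF ix] by (simp add: region ab eq_commute[of "a _ \<bullet> _"])
  qed
  show ?thesis
  proof (rule conjI)
    show "\<forall>D. D {} = 0 \<and> (\<forall>i\<in>{1..n}. D {i} = 1) \<longrightarrow>
        (\<forall>c. coverage_coeffs n D c \<longleftrightarrow> (\<forall>B. B \<noteq> {} \<and> B \<subseteq> {1..n} \<longrightarrow> c B = chat n D B))"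
      using coverage_coeffs_iff_chat by metis
  qed (use facets classical_region_eq[OF ix] assms(1) in \<open>simp add: Bs_def\<close>)
qed

end
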